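(* Let $k\ge1$ and $l\ge1$ be integers and put $\varphi=\max\{k,l-1\}$. Let $G$ be a graph of order $n$ with minimum degree $\delta$ such that $\bar\delta=\delta-\varphi>0$, and put $b_{\varphi-1}=\binom{\delta}{\varphi-1}$. Then $$\gamma_{k,l}(G)\le\left(1-\frac{\bar\delta}{(1+\bar\delta)^{1+1/\bar\delta}\; b_{\varphi-1}^{1/\bar\delta}}\right)n .$$
   Context: All graphs are finite, undirected, without loops and multiple edges (and nonempty). $N[v]$ denotes the closed neighbourhood of $v$ (the neighbours of $v$ together with $v$). For integers $k\ge1$ and $l\ge1$, a set $D\subseteq V(G)$ is a $(k,l)$-dominating set of $G$ if $|N[v]\cap D|\ge k$ for every vertex $v\notin D$ and $|N[v]\cap D|\ge l$ for every vertex $v\in D$. The parametric domination number $\gamma_{k,l}(G)$ is the minimum cardinality of a $(k,l)$-dominating set of $G$; it is considered for graphs with minimum degree at least $\max\{k,l-1\}$. *)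

theory Defs
  imports Complex_Main
begin

(* An edge is the two-element set of its end vertices; this excludes loops and multiple edges. *)
definition simple_graph :: "'a set \<Rightarrow> 'a set set \<Rightarrow> bool" where
  "simple_graph V E \<longleftrightarrow>
     finite V \<and> V \<noteq> {} \<and> E \<subseteq> {e. e \<subseteq> V \<and> card e = 2}"

definition neighbours :: "'a set \<Rightarrow> 'a set set \<Rightarrow> 'a \<Rightarrow> 'a set" where
  "neighbours V E v = {u \<in> V. {u, v} \<in> E}"

definition closed_neighbourhood :: "'a set \<Rightarrow> 'a set set \<Rightarrow> 'a \<Rightarrow> 'a set" where
  "closed_neighbourhood V E v = insert v (neighbours V E v)"

definition degree :: "'a set \<Rightarrow> 'a set set \<Rightarrow> 'a \<Rightarrow> nat" where
  "degree V E v = card (neighbours V E v)"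

definition min_degree :: "'a set \<Rightarrow> 'a set set \<Rightarrow> nat" where
  "min_degree V E = Min (degree V E ` V)"

definition kl_dominating :: "nat \<Rightarrow> nat \<Rightarrow> 'a set \<Rightarrow> 'a set set \<Rightarrow> 'a set \<Rightarrow> bool" where
  "kl_dominating k l V E D \<longleftrightarrow>
     D \<subseteq> V \<and>
     (\<forall>v \<in> V - D. card (closed_neighbourhood V E v \<inter> D) \<ge> k) \<and>
     (\<forall>v \<in> D. card (closed_neighbourhood V E v \<inter> D) \<ge> l)"

(* For minimum degree at least max k (l - 1) the whole vertex set V is (k,l)-dominating, so
   the minimum is over a nonempty finite set; otherwise the value may be unspecified. *)
definition kl_domination_number :: "nat \<Rightarrow> nat \<Rightarrow> 'a set \<Rightarrow> 'a set set \<Rightarrow> nat" where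
  "kl_domination_number k l V E = Min (card ` {D. kl_dominating k l V E D})"

end

theory Submission
  imports Defs
begin

text \<open>
  A set \<open>D\<close> of vertices such that every vertex has at least \<open>\<phi>\<close> neighbours in \<open>D\<close> is
  \<open>(k,l)\<close>-dominating, because a vertex of \<open>D\<close> lies in its own closed neighbourhood.  Such a set is
  obtained by random selection and repair.  Fix \<open>\<delta>\<close> neighbours of every vertex, and let each vertex
  of \<open>V\<close> be omitted from \<open>A\<close> independently with probability \<open>q\<close>.  If \<open>Y\<close> of the fixed neighbours
  of \<open>v\<close> are omitted and \<open>Y > \<delta>'\<close>, then adding \<open>Y - \<delta>'\<close> of them to \<open>A\<close> gives \<open>v\<close> its \<open>\<phi>\<close>
  neighbours, and \<open>Y - \<delta>' \<le> Y choose (\<delta>' + 1)\<close>.  The right-hand side counts the \<open>(\<delta>' + 1)\<close>-subsets of the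
  fixed neighbours that avoid \<open>A\<close>, so its expectation is \<open>b q^(\<delta>' + 1)\<close>, where
  \<open>b = \<delta> choose (\<delta>' + 1) = \<delta> choose (\<phi> - 1)\<close>.  Altogether some repaired set has at most
  \<open>n (1 - q + b q^(\<delta>' + 1))\<close> elements, and the value of \<open>q\<close> that minimises this expression gives the
  bound.

  The only random variables involved are the events that \<open>A\<close> avoids a given set, so the
  probabilistic part is a finite averaging statement about real combinations of such events
  (\<open>exists_subset_le_expectation\<close>).  Up to the constant \<open>n\<close>, the number of elements of \<open>A\<close> is itself
  of this form, with coefficients \<open>-1\<close> on the singletons.  The repair is \<open>exists_repair\<close>, its cost is
  averaged in \<open>exists_set_meeting_all\<close>, and \<open>q\<close> is chosen in \<open>optimal_omission_probability\<close>.
\<close>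

section \<open>Averaging over random subsets\<close>

text \<open>The left-hand side is the probability that a random subset of \<open>V\<close>, whose elements are omitted
  independently with probability \<open>q\<close>, avoids \<open>T\<close>.  The factor of an element of \<open>T\<close> in the binomial
  expansion of the product over \<open>V\<close> is \<open>0 + q\<close>, that of any other element is \<open>(1 - q) + q\<close>.\<close>

lemma sum_weights_avoiding:
  fixes q :: real
  assumes "finite V" and "T \<subseteq> V"
  shows "(\<Sum>A\<in>Pow V. (1 - q) ^ card A * q ^ card (V - A) * of_bool (T \<inter> A = {})) = q ^ card T"
proof -
  have fin: "finite A" if "A \<in> Pow V" for A
    using that assms(1) finite_subset by auto
  have "(1 - q) ^ card A * q ^ card (V - A) * of_bool (T \<inter> A = {})
      = (\<Prod>x\<in>A. (1 - q) * of_bool (x \<notin> T)) * (\<Prod>x\<in>V - A. q)" if "A \<in> Pow V" for A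
  proof -
    have "(\<Prod>x\<in>A. of_bool (x \<notin> T)) = (of_bool (T \<inter> A = {}) :: real)"
    proof (cases "T \<inter> A = {}")
      case True
      then have "of_bool (x \<notin> T) = (1 :: real)" if "x \<in> A" for x
        using that by auto
      with True show ?thesis
        by simp
    next
      case False
      then show ?thesis
        using fin[OF that] by (auto simp: prod_zero_iff)
    qed
    then show ?thesis
      by (simp add: prod.distrib)
  qed
  then have "(\<Sum>A\<in>Pow V. (1 - q) ^ card A * q ^ card (V - A) * of_bool (T \<inter> A = {}))
      = (\<Sum>A\<in>Pow V. (\<Prod>x\<in>A. (1 - q) * of_bool (x \<notin> T)) * (\<Prod>x\<in>V - A. q))"
    by (rule sum.cong[OF refl])
  also have "\<dots> = (\<Prod>x\<in>V. (1 - q) * of_bool (x \<notin> T) + q)"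
    by (rule prod_add[OF assms(1), symmetric])
  also have "\<dots> = (\<Prod>x\<in>V. if x \<in> T then q else 1)"
    by (intro prod.cong) auto
  also have "\<dots> = (\<Prod>x\<in>V \<inter> T. q)"
    by (rule prod.inter_restrict[OF assms(1), symmetric])
  also have "\<dots> = q ^ card T"
    using assms(2) by (simp add: Int_absorb1)
  finally show ?thesis .
qed

text \<open>The right-hand side of the conclusion is the expectation of the left-hand side for the random
  set above, and some set does not exceed the expectation.\<close>

lemma exists_subset_le_expectation:
  fixes q :: real and c :: "'i \<Rightarrow> real" and T :: "'i \<Rightarrow> 'a set"
  assumes "finite V" and "0 \<le> q" and "q \<le> 1" and "\<And>i. i \<in> I \<Longrightarrow> T i \<subseteq> V"
  shows "\<exists>A\<subseteq>V. (\<Sum>i\<in>I. c i * of_bool (T i \<inter> A = {})) \<le> (\<Sum>i\<in>I. c i * q ^ card (T i))"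
proof (rule ccontr)
  define w where "w A = (1 - q) ^ card A * q ^ card (V - A)" for A :: "'a set"
  define f where "f A = (\<Sum>i\<in>I. c i * of_bool (T i \<inter> A = {}))" for A
  define M where "M = (\<Sum>i\<in>I. c i * q ^ card (T i))"
  assume "\<not> ?thesis"
  then have less: "M < f A" if "A \<in> Pow V" for A
    using that unfolding f_def M_def by auto
  have w_nonneg: "0 \<le> w A" for A
    using assms(2,3) by (simp add: w_def)
  have w_sum: "(\<Sum>A\<in>Pow V. w A) = 1"
    using sum_weights_avoiding[OF assms(1), of "{}" q] by (simp add: w_def)
  have "(\<Sum>A\<in>Pow V. w A * f A)
      = (\<Sum>i\<in>I. \<Sum>A\<in>Pow V. w A * (c i * of_bool (T i \<inter> A = {})))"
    unfolding f_def sum_distrib_left by (rule sum.swap)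
  also have "\<dots> = (\<Sum>i\<in>I. c i * (\<Sum>A\<in>Pow V. w A * of_bool (T i \<inter> A = {})))"
    by (simp add: sum_distrib_left mult_ac)
  also have "\<dots> = M"
    using sum_weights_avoiding[OF assms(1) assms(4)] by (simp add: w_def M_def)
  finally have mean: "(\<Sum>A\<in>Pow V. w A * (f A - M)) = 0"
    using w_sum by (simp add: right_diff_distrib sum_subtractf flip: sum_distrib_right)
  have zero: "\<forall>A\<in>Pow V. w A * (f A - M) = 0"
  proof -
    have "0 \<le> w A * (f A - M)" if "A \<in> Pow V" for A
      using w_nonneg[of A] less[OF that] by simp
    then show ?thesis
      using mean sum_nonneg_eq_0_iff[of "Pow V" "\<lambda>A. w A * (f A - M)"] assms(1) by simp
  qed
  have "w A = 0" if "A \<in> Pow V" for A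
    using zero less[OF that] that by force
  with w_sum show False
    by simp
qed

section \<open>Domination and neighbourhoods\<close>

lemma card_neighbours_ge_min_degree:
  assumes "finite V" and "v \<in> V"
  shows "min_degree V E \<le> card (neighbours V E v)"
  using assms by (auto simp: min_degree_def degree_def intro!: Min_le)

lemma neighbours_irrefl:
  assumes "simple_graph V E"
  shows "v \<notin> neighbours V E v"
  using assms by (auto simp: simple_graph_def neighbours_def)

lemma kl_dominating_if_many_neighbours:
  assumes "simple_graph V E" and "D \<subseteq> V"
    and "\<And>v. v \<in> V \<Longrightarrow> max k (l - 1) \<le> card (neighbours V E v \<inter> D)"
  shows "kl_dominating k l V E D"
proof -
  have fin: "finite (neighbours V E v \<inter> D)" for v
    using assms(1,2) by (meson finite_Int finite_subset simple_graph_def)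
  have "k \<le> card (closed_neighbourhood V E v \<inter> D)" if "v \<in> V - D" for v
    using assms(3)[of v] that by (simp add: closed_neighbourhood_def)
  moreover have "l \<le> card (closed_neighbourhood V E v \<inter> D)" if "v \<in> D" for v
  proof -
    have "l - 1 \<le> card (neighbours V E v \<inter> D)"
      using assms(2) assms(3)[of v] that by auto
    then show ?thesis
      using that fin[of v] neighbours_irrefl[OF assms(1), of v]
      by (simp add: closed_neighbourhood_def)
  qed
  ultimately show ?thesis
    using assms(2) by (simp add: kl_dominating_def)
qed

lemma kl_domination_number_le:
  assumes "finite V" and "kl_dominating k l V E D"
  shows "kl_domination_number k l V E \<le> card D"
proof -
  have "{D. kl_dominating k l V E D} \<subseteq> Pow V"
    by (auto simp: kl_dominating_def)
  then have "finite {D. kl_dominating k l V E D}"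
    using assms(1) by (meson finite_Pow_iff finite_subset)
  then show ?thesis
    using assms(2) by (auto simp: kl_domination_number_def intro!: Min_le)
qed

section \<open>Selection and repair\<close>

text \<open>If \<open>m\<close> of the \<open>y\<close> objects are fixed, each of the other \<open>y - m\<close> completes them to a different
  subset of size \<open>m + 1\<close>.  This replaces the deficiency of a vertex by a number of subsets, whose
  expectation is easy to compute.\<close>

lemma diff_le_binomial: "y - m \<le> y choose (m + 1)"
proof (induction y)
  case (Suc y)
  show ?case
  proof (cases "m \<le> y")
    case True
    then have "1 \<le> y choose m"
      by (simp add: Suc_leI)
    then show ?thesis
      using Suc.IH by simp
  qed simp
qed simp

text \<open>If more than \<open>m\<close> of the \<open>\<phi> + m\<close> elements of \<open>S v\<close> are outside \<open>A\<close>, all but \<open>m\<close> of these are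
  added; otherwise the truncated difference is \<open>0\<close> and \<open>A\<close> already contains \<open>\<phi>\<close> of them.\<close>

lemma exists_repair:
  fixes S :: "'a \<Rightarrow> 'a set"
  assumes "finite V" and "A \<subseteq> V"
    and S: "\<And>v. v \<in> V \<Longrightarrow> S v \<subseteq> V" "\<And>v. v \<in> V \<Longrightarrow> card (S v) = \<phi> + m"
  shows "\<exists>D\<subseteq>V. (\<forall>v\<in>V. \<phi> \<le> card (S v \<inter> D)) \<and>
    card D \<le> card A + (\<Sum>v\<in>V. card (S v - A) - m)"
proof -
  have "\<exists>B. B \<subseteq> S v - A \<and> card B = card (S v - A) - m" for v
    using obtain_subset_with_card_n[of "card (S v - A) - m" "S v - A"] by auto
  then obtain B where B: "\<And>v. B v \<subseteq> S v - A" "\<And>v. card (B v) = card (S v - A) - m"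
    by metis
  define D where "D = A \<union> (\<Union>v\<in>V. B v)"
  have "D \<subseteq> V"
    using assms(2) S(1) B(1) by (fastforce simp: D_def)
  moreover have "\<phi> \<le> card (S v \<inter> D)" if v: "v \<in> V" for v
  proof -
    have fin: "finite (S v)"
      using S(1)[OF v] assms(1) finite_subset by blast
    have "card (S v \<inter> A) + card (S v - A) = \<phi> + m"
      using S(2)[OF v] fin by (metis card_Int_Diff)
    then have "\<phi> \<le> card (S v \<inter> A) + card (B v)"
      using B(2)[of v] by simp
    also have "\<dots> = card (S v \<inter> A \<union> B v)"
      using B(1)[of v] fin by (intro card_Un_disjoint[symmetric]) (auto intro: finite_subset)
    also have "\<dots> \<le> card (S v \<inter> D)"
      using B(1)[of v] fin v by (intro card_mono) (auto simp: D_def)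
    finally show ?thesis .
  qed
  moreover have "card D \<le> card A + (\<Sum>v\<in>V. card (S v - A) - m)"
  proof -
    have "card D \<le> card A + card (\<Union>v\<in>V. B v)"
      unfolding D_def by (rule card_Un_le)
    also have "card (\<Union>v\<in>V. B v) \<le> (\<Sum>v\<in>V. card (B v))"
      by (rule card_UN_le[OF assms(1)])
    finally show ?thesis
      by (simp add: B(2))
  qed
  ultimately show ?thesis
    by blast
qed

text \<open>The averaging statement is applied to the family consisting of the singletons, with
  coefficient \<open>-1\<close>, and of the \<open>(m + 1)\<close>-subsets of the sets \<open>S v\<close>.  Its value at \<open>A\<close> is
  \<open>card A - card V\<close> plus the total upper bound for the deficiencies.\<close>

lemma exists_set_meeting_all:
  fixes S :: "'a \<Rightarrow> 'a set" and q :: real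
  assumes "finite V" and "0 \<le> q" and "q \<le> 1"
    and S: "\<And>v. v \<in> V \<Longrightarrow> S v \<subseteq> V" "\<And>v. v \<in> V \<Longrightarrow> card (S v) = \<phi> + m"
  shows "\<exists>D\<subseteq>V. (\<forall>v\<in>V. \<phi> \<le> card (S v \<inter> D)) \<and>
    real (card D) \<le> (1 - q + real ((\<phi> + m) choose (m + 1)) * q ^ (m + 1)) * real (card V)"
proof -
  define P where "P v = {T. T \<subseteq> S v \<and> card T = m + 1}" for v
  define I where "I = Inl ` V \<union> Inr ` (SIGMA v:V. P v)"
  define T where "T i = (case i of Inl v \<Rightarrow> {v} | Inr vT \<Rightarrow> snd vT)" for i :: "'a + 'a \<times> 'a set"
  define c :: "'a + 'a \<times> 'a set \<Rightarrow> real" where "c i = (case i of Inl v \<Rightarrow> -1 | Inr _ \<Rightarrow> 1)" for i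
  have finS: "finite (S v)" if "v \<in> V" for v
    using S(1)[OF that] assms(1) finite_subset by blast
  have finP: "finite (P v)" if "v \<in> V" for v
    using finS[OF that] by (simp add: P_def)
  have split: "(\<Sum>i\<in>I. c i * g (T i)) = (\<Sum>v\<in>V. \<Sum>T\<in>P v. g T) - (\<Sum>v\<in>V. g {v})"
    for g :: "'a set \<Rightarrow> real"
  proof -
    have "(\<Sum>i\<in>I. c i * g (T i))
        = (\<Sum>i\<in>Inl ` V. c i * g (T i)) + (\<Sum>i\<in>Inr ` (SIGMA v:V. P v). c i * g (T i))"
      unfolding I_def using assms(1) finP by (intro sum.union_disjoint) auto
    also have "(\<Sum>i\<in>Inl ` V. c i * g (T i)) = - (\<Sum>v\<in>V. g {v})"
      by (subst sum.reindex) (auto simp: c_def T_def sum_negf)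
    also have "(\<Sum>i\<in>Inr ` (SIGMA v:V. P v). c i * g (T i)) = (\<Sum>v\<in>V. \<Sum>T\<in>P v. g T)"
      using assms(1) finP
      by (subst sum.reindex) (auto simp: c_def T_def sum.Sigma split_def)
    finally show ?thesis
      by simp
  qed
  have "T i \<subseteq> V" if "i \<in> I" for i
  proof -
    from that consider v where "v \<in> V" "i = Inl v" | v U where "v \<in> V" "U \<in> P v" "i = Inr (v, U)"
      by (auto simp: I_def)
    then show ?thesis
    proof cases
      case 1
      then show ?thesis
        by (simp add: T_def)
    next
      case 2
      then show ?thesis
        using S(1)[of v] by (auto simp: T_def P_def)
    qed
  qed
  from exists_subset_le_expectation[where c = c and I = I and T = T, OF assms(1-3) this]
  obtain A where A: "A \<subseteq> V"
    and le: "(\<Sum>i\<in>I. c i * of_bool (T i \<inter> A = {})) \<le> (\<Sum>i\<in>I. c i * q ^ card (T i))"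
    by auto
  have "card (P v) = (\<phi> + m) choose (m + 1)" if "v \<in> V" for v
    using n_subsets[OF finS[OF that], of "m + 1"] S(2)[OF that] by (simp add: P_def)
  then have "(\<Sum>T\<in>P v. q ^ card T) = real ((\<phi> + m) choose (m + 1)) * q ^ (m + 1)" if "v \<in> V" for v
    using that by (simp add: P_def)
  then have mean: "(\<Sum>i\<in>I. c i * q ^ card (T i))
      = real (card V) * (real ((\<phi> + m) choose (m + 1)) * q ^ (m + 1)) - real (card V) * q"
    using split[of "\<lambda>T. q ^ card T"] by simp
  have avoid: "(\<Sum>T\<in>P v. of_bool (T \<inter> A = {})) = real (card (S v - A) choose (m + 1))"
    if "v \<in> V" for v
  proof -
    have "(\<Sum>T\<in>P v. of_bool (T \<inter> A = {})) = real (card {T \<in> P v. T \<inter> A = {}})"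
      using finP[OF that] by (simp add: Int_def)
    also have "{T \<in> P v. T \<inter> A = {}} = {T. T \<subseteq> S v - A \<and> card T = m + 1}"
      by (auto simp: P_def)
    finally show ?thesis
      using finS[OF that] by (simp add: n_subsets)
  qed
  have "(\<Sum>v\<in>V. of_bool ({v} \<inter> A = {})) = real (card (V - A))"
    using assms(1) by (simp add: set_diff_eq Int_def)
  also have "\<dots> = real (card V) - real (card A)"
    using A assms(1) by (simp add: card_Diff_subset card_mono finite_subset of_nat_diff)
  finally have at_A: "(\<Sum>i\<in>I. c i * of_bool (T i \<inter> A = {}))
      = (\<Sum>v\<in>V. real (card (S v - A) choose (m + 1))) - (real (card V) - real (card A))"
    using split[of "\<lambda>T. of_bool (T \<inter> A = {})"] avoid by simp
  from exists_repair[of V A S \<phi> m, OF assms(1) A S]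
  obtain D where D: "D \<subseteq> V" "\<forall>v\<in>V. \<phi> \<le> card (S v \<inter> D)"
    "card D \<le> card A + (\<Sum>v\<in>V. card (S v - A) - m)"
    by auto
  note D(3)
  also have "(\<Sum>v\<in>V. card (S v - A) - m) \<le> (\<Sum>v\<in>V. card (S v - A) choose (m + 1))"
    by (intro sum_mono diff_le_binomial)
  finally have "real (card D) \<le> real (card A) + (\<Sum>v\<in>V. real (card (S v - A) choose (m + 1)))"
    by (simp flip: of_nat_sum of_nat_add)
  with le mean at_A
  have "real (card D) \<le> (1 - q + real ((\<phi> + m) choose (m + 1)) * q ^ (m + 1)) * real (card V)"
    by (simp add: algebra_simps)
  with D show ?thesis
    by blast
qed

section \<open>The bound on the domination number\<close>

text \<open>The minimum over \<open>q\<close> of \<open>1 - q + b q^(m + 1)\<close> is attained where the derivative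
  \<open>-1 + b (m + 1) q^m\<close> vanishes.\<close>

lemma optimal_omission_probability:
  fixes b :: real and m :: nat
  assumes "1 \<le> b" and "0 < m"
  obtains q where "0 \<le> q" and "q \<le> 1"
    and "1 - q + b * q ^ (m + 1)
      = 1 - real m / ((1 + real m) powr (1 + 1 / real m) * b powr (1 / real m))"
proof
  define q where "q = (b * (1 + real m)) powr (- (1 / real m))"
  have base: "1 \<le> b * (1 + real m)"
    using mult_mono[of 1 b 1 "1 + real m"] assms(1) by simp
  show "0 \<le> q"
    by (simp add: q_def)
  show "q \<le> 1"
    using powr_mono[of "- (1 / real m)" 0, OF _ base] base assms(1) by (simp add: q_def)
  have "q ^ m = 1 / (b * (1 + real m))"
  proof -
    have "0 < q"
      using base assms(1) by (simp add: q_def)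
    then have "q ^ m = q powr real m"
      by (simp add: powr_realpow)
    also have "\<dots> = (b * (1 + real m)) powr (-1)"
      using assms(2) by (simp add: q_def powr_powr)
    finally show ?thesis
      using base by (simp add: powr_minus_divide)
  qed
  then have "b * q ^ m = 1 / (1 + real m)"
    using assms(1) by simp
  then have "b * q ^ (m + 1) = q / (1 + real m)"
    by (simp add: mult.left_commute[of b q])
  then have "1 - q + b * q ^ (m + 1) = 1 - q * (real m / (1 + real m))"
    by (simp add: field_simps)
  also have "q * (real m / (1 + real m))
      = real m / ((1 + real m) powr (1 + 1 / real m) * b powr (1 / real m))"
    using assms(1) by (simp add: q_def powr_minus_divide powr_mult powr_add mult_ac)
  finally show "1 - q + b * q ^ (m + 1)
      = 1 - real m / ((1 + real m) powr (1 + 1 / real m) * b powr (1 / real m))" .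
qed

theorem theorem5:
  fixes k l \<phi> n \<delta> b :: nat
    and \<delta>' :: real
    and V :: "'a set" and E :: "'a set set"
  assumes "k \<ge> 1" and "l \<ge> 1"
    and "\<phi> = max k (l - 1)"
    and "simple_graph V E"
    and "n = card V"
    and "\<delta> = min_degree V E"
    and "\<delta>' = real \<delta> - real \<phi>"
    and "\<delta>' > 0"
    and "b = \<delta> choose (\<phi> - 1)"
  shows "real (kl_domination_number k l V E)
           \<le> (1 - \<delta>' / ((1 + \<delta>') powr (1 + 1 / \<delta>') * real b powr (1 / \<delta>'))) * real n"
proof -
  have V: "finite V"
    using assms(4) by (simp add: simple_graph_def)
  define m where "m = \<delta> - \<phi>"
  have m: "0 < m" "\<delta>' = real m" "\<phi> + m = \<delta>" and "1 \<le> \<phi>"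
    using assms(1,3,7,8) by (auto simp: m_def)
  then have b: "b = (\<phi> + m) choose (m + 1)" "1 \<le> real b"
    using binomial_symmetric[of "\<phi> - 1" \<delta>] assms(9) by (auto simp: Suc_leI)
  obtain q where q: "0 \<le> q" "q \<le> 1" and opt: "1 - q + real b * q ^ (m + 1)
      = 1 - real m / ((1 + real m) powr (1 + 1 / real m) * real b powr (1 / real m))"
    using optimal_omission_probability[OF b(2) m(1)] by blast
  have "\<exists>S. S \<subseteq> neighbours V E v \<and> card S = \<phi> + m" if "v \<in> V" for v
    using obtain_subset_with_card_n[of "\<phi> + m" "neighbours V E v"]
      card_neighbours_ge_min_degree[OF V that, of E] assms(6) m(3) by auto
  then obtain S where S: "\<And>v. v \<in> V \<Longrightarrow> S v \<subseteq> neighbours V E v"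
    "\<And>v. v \<in> V \<Longrightarrow> card (S v) = \<phi> + m"
    by metis
  have "S v \<subseteq> V" if "v \<in> V" for v
    using S(1)[OF that] by (auto simp: neighbours_def)
  from exists_set_meeting_all[of V q S \<phi> m, OF V q this S(2)]
  obtain D where D: "D \<subseteq> V" "\<forall>v\<in>V. \<phi> \<le> card (S v \<inter> D)"
    and card_D: "real (card D) \<le> (1 - q + real b * q ^ (m + 1)) * real (card V)"
    unfolding b(1)[symmetric] by auto
  have "\<phi> \<le> card (neighbours V E v \<inter> D)" if "v \<in> V" for v
  proof -
    have "card (S v \<inter> D) \<le> card (neighbours V E v \<inter> D)"
      using S(1)[OF that] D(1) V by (intro card_mono) (auto intro: finite_subset)
    then show ?thesis
      using D(2) that by fastforce
  qed
  then have "kl_dominating k l V E D"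
    using kl_dominating_if_many_neighbours[OF assms(4) D(1)] assms(3) by blast
  then have "real (kl_domination_number k l V E) \<le> real (card D)"
    using kl_domination_number_le[OF V] by simp
  also note card_D
  finally show ?thesis
    unfolding opt m(2) assms(5) .
qed

end
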